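(* For every integer $p\ge 1$, $$\varphi(2p) = \frac{A_p}{4^p}\,\pi^{2p}.$$
   Context: For real $x>0$, $\xi(x)=\sum_{n=1}^{+\infty}\frac{(-1)^{n-1}}{n^x}$ and $\varphi(x)=\sum_{m=1}^{+\infty}\frac{(-1)^{m-1}}{(2m)^x}$. The numbers $A_p$ ($p\ge 1$) are defined by $A_p = \xi(2p)/\pi^{2p}$; they are rational and determined by $A_1=\frac{1}{12}$ and, for $p\ge 2$, $A_p = \frac{(-1)^{p-1}}{(2p)!}\left(\frac{1}{2(2p+1)} - \sum_{k=1}^{p-1}(-1)^{k-1}\frac{(2p)!}{(2p+1-2k)!}A_k\right)$. *)

theory Defs
  imports Complex_Main
begin

text \<open>
  Both series are only conditionally convergent for small positive exponents, so they are taken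
  as limits of partial sums (\<^const>\<open>suminf\<close>). The index is shifted to start at \<open>0\<close>: the summation
  variable \<open>n\<close> below stands for \<open>n - 1\<close> in the usual notation, hence the sign \<open>(-1) ^ n\<close>.
\<close>

definition xi :: "real \<Rightarrow> real" where
  "xi x = (\<Sum>n. (-1) ^ n / real (Suc n) powr x)"

definition phi :: "real \<Rightarrow> real" where
  "phi x = (\<Sum>m. (-1) ^ m / real (2 * Suc m) powr x)"

text \<open>Meaningful for \<open>p \<ge> 1\<close> only.\<close>

definition A :: "nat \<Rightarrow> real" where
  "A p = xi (real (2 * p)) / pi ^ (2 * p)"

lemma summable_alternating_powr:
  fixes x :: real
  assumes "x > 0" "c > 0"
  shows "summable (\<lambda>n. (-1) ^ n / real (c * Suc n) powr x)"
proof -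
  have top: "filterlim (\<lambda>n. real (c * Suc n)) at_top sequentially"
  proof (rule filterlim_at_top_mono[OF filterlim_real_sequentially])
    have "n \<le> c * Suc n" for n using assms(2) by (cases c) auto
    then show "\<forall>\<^sub>F n in sequentially. real n \<le> real (c * Suc n)"
      by (intro always_eventually allI) (simp only: of_nat_le_iff)
  qed
  have lim: "(\<lambda>n. real (c * Suc n) powr (- x)) \<longlonglongrightarrow> 0"
    by (rule tendsto_neg_powr[OF _ top]) (use assms in simp)
  have "summable (\<lambda>n. (-1) ^ n * real (c * Suc n) powr (- x))"
  proof (rule summable_Leibniz'(1)[OF lim])
    show "0 \<le> real (c * Suc n) powr (- x)" for n by simp
    show "real (c * Suc (Suc n)) powr (- x) \<le> real (c * Suc n) powr (- x)" for n
      by (rule powr_mono2') (use assms in \<open>auto simp del: of_nat_mult\<close>)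
  qed
  then show ?thesis
    by (simp add: powr_minus divide_inverse)
qed

lemma xi_summable: "x > 0 \<Longrightarrow> summable (\<lambda>n. (-1) ^ n / real (Suc n) powr x)"
  using summable_alternating_powr[of x 1] by simp

lemma phi_summable: "x > 0 \<Longrightarrow> summable (\<lambda>m. (-1) ^ m / real (2 * Suc m) powr x)"
  by (rule summable_alternating_powr) auto

end

theory Submission
  imports Defs
begin

text \<open>Each denominator splits as (2n)^x = 2^x n^x, so the constant 2^x leaves the sum and phi
  is a rescaled xi (\<open>phi_eq_xi\<close>). At x = 2p the constant is 4^p.\<close>

lemma phi_eq_xi:
  assumes "x > 0"
  shows "phi x = xi x / 2 powr x"
proof -
  have "phi x = (\<Sum>n. (-1) ^ n / real (Suc n) powr x / 2 powr x)"
    unfolding phi_def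
  proof (rule suminf_cong)
    fix n :: nat
    have "real (2 * Suc n) powr x = 2 powr x * real (Suc n) powr x"
      by (simp only: of_nat_mult of_nat_numeral powr_mult)
    then show "(-1) ^ n / real (2 * Suc n) powr x = (-1) ^ n / real (Suc n) powr x / 2 powr x"
      by (simp only: divide_divide_eq_left mult.commute)
  qed
  \<comment> \<open>Convergence lets the constant pass through \<open>suminf\<close>;
    \<open>x > 0\<close> enters here.\<close>
  also have "\<dots> = xi x / 2 powr x"
    unfolding xi_def using xi_summable[OF assms] by (rule suminf_divide)
  finally show ?thesis .
qed

theorem proposition3:
  fixes p :: nat
  assumes "p \<ge> 1"
  shows "phi (real (2 * p)) = A p / 4 ^ p * pi ^ (2 * p)"
proof -
  have "(2::real) powr real (2 * p) = 4 ^ p"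
    by (simp only: powr_realpow power_mult) simp
  then have "phi (real (2 * p)) = xi (real (2 * p)) / 4 ^ p"
    using phi_eq_xi[of "real (2 * p)"] assms by simp
  \<comment> \<open>The power of \<open>pi\<close> cancels the one dividing xi(2p) in
    \<open>A p\<close>.\<close>
  then show ?thesis
    by (simp add: A_def)
qed

end
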